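(* Let $\beta\geq 0$ be a real number, and let $(a_n)_{n=1}^\infty$ be a sequence of positive integers satisfying \[ \left|\frac{a_n^2}{a_{n+1}}-\beta\right|\leq\frac{1}{3}\ \text{ for all } n\geq 1,\qquad \sum_{n=1}^\infty\frac{1}{a_n}=r<\infty. \] Then, for every $n\ge 1$ satisfying $a_n\geq 8\left(\beta+\frac13\right)^2$, we have \[ a_n = \left\lfloor\left(r-\sum_{k=1}^{n-1}\frac{1}{a_k}\right)^{-1}+\beta\right\rceil . \] Moreover, if $\lim_{n\to \infty}a_n^2/a_{n+1}=\beta$, then \[ \lim_{n\to \infty}\left|\left(r-\sum_{k=1}^{n-1}\frac{1}{a_k}\right)^{-1}+\beta-a_n\right|=0. \]
   Context: For a real number $x$, $\lfloor x\rceil:=\lfloor x+\tfrac12\rfloor$ denotes the integer closest to $x$ (ties rounded up). *)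

theory Defs
  imports Complex_Main
begin

end

theory Submission
  imports Defs
begin

text \<open>
  Put $f_c(x) = 1/(x - c)$ and let $y = x^2/e$ be the successor of $x$ in the sequence. Comparing
  $1/x$ with $f_c(x) - f_c(y)$ amounts to comparing $x^2 (e - c)/e$ with $c(x - c)$. For large $x$ the
  sign is decided by $e - c$, so that $1/x < f_c(x) - f_c(y)$ for $c = \<beta> + \<delta>$ and the reverse
  inequality holds for $c = \<beta> - \<delta>$, whenever $|e - \<beta>| \le \<eta> < \<delta>$. Telescoping squeezes
  the tail $R_n$ of the series between $f_{\<beta>-\<delta>}(a_n)$ and $f_{\<beta>+\<delta>}(a_n)$, that is,
  $|1/R_n + \<beta> - a_n| < \<delta>$. The rounding formula is the case $\<eta> = 1/3$, $\<delta> = 1/2$.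
\<close>

text \<open>Both equivalences come from clearing the positive common denominator
  \<open>x * (x - c) * (y - c)\<close>.\<close>

lemma inverse_less_telescope_iff:
  fixes x y c :: real
  assumes "0 < x" "c < x" "c < y"
  shows "1 / x < 1 / (x - c) - 1 / (y - c) \<longleftrightarrow> x * (x - c) < c * (y - c)"
    and "1 / (x - c) - 1 / (y - c) < 1 / x \<longleftrightarrow> c * (y - c) < x * (x - c)"
proof -
  define D where "D = x * (x - c) * (y - c)"
  have "D > 0"
    using assms by (simp add: D_def)
  moreover have "1 / (x - c) - 1 / (y - c) - 1 / x = (c * (y - c) - x * (x - c)) / D"
    using assms by (simp add: D_def divide_simps) (simp add: algebra_simps)
  ultimately show "1 / x < 1 / (x - c) - 1 / (y - c) \<longleftrightarrow> x * (x - c) < c * (y - c)"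
    and "1 / (x - c) - 1 / (y - c) < 1 / x \<longleftrightarrow> c * (y - c) < x * (x - c)"
    using zero_less_divide_iff[of "c * (y - c) - x * (x - c)" D]
      divide_less_0_iff[of "c * (y - c) - x * (x - c)" D]
    by linarith+
qed

text \<open>With \<open>c = \<beta> + \<delta>\<close> the ratio is below \<open>c\<close>, so
  \<open>x\<^sup>2 < c * y\<close>; adding \<open>c * c < c * x\<close> gives the criterion.\<close>

lemma inverse_less_telescope:
  fixes x y \<beta> \<delta> \<eta> :: real
  assumes "0 \<le> \<beta>" "\<eta> < \<delta>" "0 < y" "\<bar>x\<^sup>2 / y - \<beta>\<bar> \<le> \<eta>" "\<beta> + \<delta> < x" "\<beta> + \<delta> < y"
  shows "1 / x < 1 / (x - (\<beta> + \<delta>)) - 1 / (y - (\<beta> + \<delta>))"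
proof -
  define c where "c = \<beta> + \<delta>"
  have "0 < c" "c < x" "c < y"
    using assms by (auto simp: c_def)
  have "x\<^sup>2 / y < c"
    using assms by (simp add: c_def)
  then have "x\<^sup>2 < c * y"
    using \<open>0 < y\<close> by (simp add: divide_less_eq)
  moreover have "c * c < c * x"
    using \<open>0 < c\<close> \<open>c < x\<close> by simp
  ultimately have "x * (x - c) < c * (y - c)"
    by (simp add: power2_eq_square algebra_simps)
  then show ?thesis
    using inverse_less_telescope_iff(1)[of x c y] \<open>0 < c\<close> \<open>c < x\<close> \<open>c < y\<close> by (simp add: c_def)
qed

text \<open>If \<open>c = \<beta> - \<delta>\<close> is not positive, the criterion holds by signs
  alone. Otherwise the gap \<open>e - c\<close> is at least \<open>\<delta> - \<eta>\<close>, and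
  \<open>large\<close> makes \<open>x\<close> times this gap dominate \<open>c * e\<close>.\<close>

lemma telescope_less_inverse:
  fixes x y \<beta> \<delta> \<eta> :: real
  assumes "0 \<le> \<beta>" "\<eta> < \<delta>" "0 < y" "\<bar>x\<^sup>2 / y - \<beta>\<bar> \<le> \<eta>" "\<beta> + \<delta> < x" "\<beta> + \<delta> < y"
    and large: "\<beta> * (\<beta> + \<eta>) \<le> x * (\<delta> - \<eta>)"
  shows "1 / (x - (\<beta> - \<delta>)) - 1 / (y - (\<beta> - \<delta>)) < 1 / x"
proof -
  define c where "c = \<beta> - \<delta>"
  define e where "e = x\<^sup>2 / y"
  have "0 < x" "c < x" "c < y" "0 < \<delta>"
    using assms by (auto simp: c_def)
  then have e: "0 < e" "e \<le> \<beta> + \<eta>" "\<delta> - \<eta> \<le> e - c" and x2: "x\<^sup>2 = e * y"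
    using assms by (auto simp: c_def e_def)
  have "c * (y - c) < x * (x - c)"
  proof (cases "c \<le> 0")
    case True
    then have "c * (y - c) \<le> 0"
      using \<open>c < y\<close> by (simp add: mult_nonpos_nonneg)
    also have "0 < x * (x - c)"
      using \<open>0 < x\<close> \<open>c < x\<close> by simp
    finally show ?thesis .
  next
    case False
    have "c * e \<le> \<beta> * (\<beta> + \<eta>)"
      using e False \<open>0 < \<delta>\<close> by (intro mult_mono) (auto simp: c_def)
    also have "\<dots> \<le> x * (\<delta> - \<eta>)"
      by (rule large)
    also have "\<dots> \<le> x * (e - c)"
      using e \<open>0 < x\<close> by simp
    \<comment> \<open>The extra factor \<open>x\<close> turns \<open>x\<^sup>2\<close> into
      \<open>e * y\<close>, after which \<open>e\<close> cancels and
      \<open>c * x + c * y \<le> x\<^sup>2\<close> remains.\<close>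
    finally have "c * e * x \<le> x * (e - c) * x"
      using \<open>0 < x\<close> by (intro mult_right_mono) auto
    also have "\<dots> = e * y * (e - c)"
      by (simp add: x2[symmetric] power2_eq_square)
    finally have "e * (c * x) \<le> e * (y * (e - c))"
      by (simp add: mult_ac)
    then have "c * x \<le> y * (e - c)"
      using \<open>0 < e\<close> by simp
    moreover have "c * c > 0"
      using False by simp
    ultimately show ?thesis
      using x2 by (simp add: power2_eq_square algebra_simps)
  qed
  then show ?thesis
    using inverse_less_telescope_iff(2)[of x c y] \<open>0 < x\<close> \<open>c < x\<close> \<open>c < y\<close> by (simp add: c_def)
qed

lemma sums_strict_less:
  fixes f g :: "nat \<Rightarrow> real"
  assumes "f sums s" "g sums t" "\<And>k. f k < g k"
  shows "s < t"
proof -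
  have "(\<lambda>k. g k - f k) sums (t - s)"
    by (intro sums_diff assms)
  then have "0 < t - s"
    using suminf_pos[of "\<lambda>k. g k - f k"] assms(3) by (simp add: sums_iff)
  then show ?thesis
    by simp
qed

lemma inverse_sums_imp_at_top:
  fixes b :: "nat \<Rightarrow> real"
  assumes "(\<lambda>k. 1 / b k) sums s" "\<And>k. 0 < b k"
  shows "filterlim b at_top sequentially"
proof -
  have "(\<lambda>k. 1 / b k) \<longlonglongrightarrow> 0"
    using assms(1) sums_summable summable_LIMSEQ_zero by blast
  then have "filterlim (\<lambda>k. inverse (1 / b k)) at_top sequentially"
    using assms(2) by (intro filterlim_inverse_at_top) auto
  then show ?thesis
    by simp
qed

text \<open>Common core of both claims: \<open>b\<close> is the sequence started at index n and
  \<open>s\<close> the tail of the series from there. Rounding uses a fixed pair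
  (\<open>\<eta>\<close>, \<open>\<delta>\<close>), the limit uses
  \<open>\<eta> = \<delta> / 2\<close> with \<open>\<delta>\<close> arbitrary.\<close>

lemma inverse_tail_approx:
  fixes b :: "nat \<Rightarrow> real" and \<beta> \<delta> \<eta> s :: real
  assumes "0 \<le> \<beta>" "\<eta> < \<delta>"
    and ratio: "\<And>k. \<bar>(b k)\<^sup>2 / b (Suc k) - \<beta>\<bar> \<le> \<eta>"
    and b_gt: "\<And>k. \<beta> + \<delta> < b k"
    and large: "\<And>k. \<beta> * (\<beta> + \<eta>) \<le> b k * (\<delta> - \<eta>)"
    and sums: "(\<lambda>k. 1 / b k) sums s"
  shows "\<bar>inverse s + \<beta> - b 0\<bar> < \<delta>"
proof -
  have "0 < \<delta>"
    using assms(2) ratio[of 0] by linarith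
  then have pos: "0 < b k" for k
    using b_gt[of k] \<open>0 \<le> \<beta>\<close> by linarith
  \<comment> \<open>The terms \<open>b k\<close> tend to infinity because their reciprocals are
    summable, so only the first term of the telescoping sum survives.\<close>
  have telescope: "(\<lambda>k. 1 / (b k - c) - 1 / (b (Suc k) - c)) sums (1 / (b 0 - c))" for c
  proof -
    have "filterlim (\<lambda>k. - c + b k) at_top sequentially"
      using inverse_sums_imp_at_top[OF sums pos] by (intro filterlim_tendsto_add_at_top) auto
    then have "(\<lambda>k. 1 / (b k - c)) \<longlonglongrightarrow> 0"
      using tendsto_inverse_0_at_top by (fastforce simp: inverse_eq_divide)
    from telescope_sums'[OF this] show ?thesis
      by simp
  qed
  have "s < 1 / (b 0 - (\<beta> + \<delta>))"
    using inverse_less_telescope[OF assms(1,2) pos ratio b_gt b_gt]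
    by (rule sums_strict_less[OF sums telescope])
  moreover have lower: "1 / (b 0 - (\<beta> - \<delta>)) < s"
    using telescope_less_inverse[OF assms(1,2) pos ratio b_gt b_gt large]
    by (rule sums_strict_less[OF telescope sums])
  moreover have "b 0 - (\<beta> + \<delta>) > 0" "b 0 - (\<beta> - \<delta>) > 0"
    using b_gt[of 0] \<open>0 < \<delta>\<close> by linarith+
  \<comment> \<open>Positivity of \<open>s\<close> is what permits passing to reciprocals in both
    bounds.\<close>
  moreover from this lower have "s > 0"
    by (meson less_trans zero_less_divide_1_iff)
  ultimately have "b 0 - (\<beta> + \<delta>) < inverse s" "inverse s < b 0 - (\<beta> - \<delta>)"
    by (simp_all add: field_simps)
  then show ?thesis
    by linarith
qed

lemma sums_tail:
  fixes f :: "nat \<Rightarrow> real"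
  assumes "(\<lambda>n. f (n + 1)) sums r" "n \<ge> 1"
  shows "(\<lambda>k. f (n + k)) sums (r - (\<Sum>k\<in>{1..<n}. f k))"
proof -
  \<comment> \<open>Summation starts at index 1, so the tail from \<open>n\<close> drops
    \<open>n - 1\<close> terms.\<close>
  obtain m where n: "n = Suc m"
    using assms(2) by (cases n) auto
  have "(\<lambda>k. f (k + m + 1)) sums (r - (\<Sum>i<m. f (i + 1)))"
    by (rule sums_split_initial_segment[OF assms(1)])
  moreover have "(\<Sum>i<m. f (i + 1)) = (\<Sum>k\<in>{1..<n}. f k)"
    unfolding n using sum.shift_bounds_Suc_ivl[of f 0 m] by (simp add: atLeast0LessThan)
  ultimately show ?thesis
    by (simp add: n add.commute)
qed

theorem theorem1:
  fixes \<beta> r :: real and a :: "nat \<Rightarrow> nat"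
  assumes "\<beta> \<ge> 0"
    and "\<And>n. n \<ge> 1 \<Longrightarrow> a n > 0"
    and "\<And>n. n \<ge> 1 \<Longrightarrow> \<bar>real (a n) ^ 2 / real (a (n + 1)) - \<beta>\<bar> \<le> 1 / 3"
    and "(\<lambda>n. 1 / real (a (n + 1))) sums r"
  shows "(\<forall>n\<ge>1. real (a n) \<ge> 8 * (\<beta> + 1 / 3) ^ 2 \<longrightarrow>
            int (a n) = round (inverse (r - (\<Sum>k\<in>{1..<n}. 1 / real (a k))) + \<beta>))
       \<and> ((\<lambda>n. real (a n) ^ 2 / real (a (n + 1))) \<longlonglongrightarrow> \<beta> \<longrightarrow>
            (\<lambda>n. \<bar>inverse (r - (\<Sum>k\<in>{1..<n}. 1 / real (a k))) + \<beta> - real (a n)\<bar>) \<longlonglongrightarrow> 0)"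
proof (intro conjI allI impI)
  fix n :: nat
  assume n: "n \<ge> 1" and an: "real (a n) \<ge> 8 * (\<beta> + 1 / 3) ^ 2"
  define B where "B = \<beta> + 1 / 3"
  have B: "B \<ge> 1 / 3"
    using assms(1) by (simp add: B_def)
  \<comment> \<open>The size condition is inherited by later terms: since
    \<open>B \<ge> 1 / 3\<close>, it gives \<open>B \<le> a k\<close>, so the ratio is at most
    \<open>a k\<close> and the sequence does not decrease.\<close>
  have step: "real (a k) \<le> real (a (k + 1))" if "k \<ge> 1" "8 * B\<^sup>2 \<le> real (a k)" for k
  proof -
    have pos: "real (a k) > 0" "real (a (k + 1)) > 0"
      using assms(2)[of k] assms(2)[of "k + 1"] that by auto
    have "B * 1 \<le> B * (8 * B)"
      using B by (intro mult_left_mono) auto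
    then have "B \<le> real (a k)"
      using that(2) by (simp add: power2_eq_square)
    have "(real (a k))\<^sup>2 / real (a (k + 1)) \<le> B"
      using assms(3)[OF that(1)] unfolding B_def by linarith
    also note \<open>B \<le> real (a k)\<close>
    finally have "real (a k) * real (a k) \<le> real (a k) * real (a (k + 1))"
      using pos by (simp add: divide_le_eq power2_eq_square)
    then show ?thesis
      using pos by simp
  qed
  have large: "8 * B\<^sup>2 \<le> real (a (n + k))" for k
  proof (induction k)
    case 0
    then show ?case using an by (simp add: B_def)
  next
    case (Suc k)
    then show ?case using step[of "n + k"] n by simp
  qed
  have "B\<^sup>2 \<ge> 1 / 3 * B"
    using B mult_right_mono[of "1 / 3" B B] by (simp add: power2_eq_square)
  \<comment> \<open>Writing \<open>n + 0\<close> matches \<open>b 0\<close> for the shifted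
    sequence.\<close>
  have "\<bar>inverse (r - (\<Sum>k\<in>{1..<n}. 1 / real (a k))) + \<beta> - real (a (n + 0))\<bar> < 1 / 2"
  proof (rule inverse_tail_approx[where b = "\<lambda>k. real (a (n + k))" and \<eta> = "1 / 3"])
    fix k
    show "\<bar>(real (a (n + k)))\<^sup>2 / real (a (n + Suc k)) - \<beta>\<bar> \<le> 1 / 3"
      using assms(3)[of "n + k"] n by simp
    \<comment> \<open>\<open>B \<ge> 1 / 3\<close> turns the quadratic bound into a linear one:
      \<open>8 * B\<^sup>2 \<ge> 8 / 3 * B\<close>.\<close>
    have "\<beta> + 1 / 2 < 8 / 3 * B"
      using assms(1) by (simp add: B_def)
    then show "\<beta> + 1 / 2 < real (a (n + k))"
      using large[of k] \<open>B\<^sup>2 \<ge> 1 / 3 * B\<close> by linarith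
    \<comment> \<open>Here \<open>\<delta> - \<eta> = 1 / 6\<close>, and
      \<open>8 * B\<^sup>2 / 6 \<ge> B\<^sup>2\<close>.\<close>
    have "\<beta> * (\<beta> + 1 / 3) \<le> B\<^sup>2"
      using assms(1) by (simp add: B_def power2_eq_square mult_right_mono)
    also have "B\<^sup>2 \<le> real (a (n + k)) * (1 / 2 - 1 / 3)"
      using large[of k] zero_le_power2[of B] by simp
    finally show "\<beta> * (\<beta> + 1 / 3) \<le> real (a (n + k)) * (1 / 2 - 1 / 3)" .
    show "(\<lambda>k. 1 / real (a (n + k))) sums (r - (\<Sum>k\<in>{1..<n}. 1 / real (a k)))"
      by (rule sums_tail[OF assms(4) n])
  qed (use assms(1) in auto)
  then have "\<bar>inverse (r - (\<Sum>k\<in>{1..<n}. 1 / real (a k))) + \<beta> - real_of_int (int (a n))\<bar> < 1 / 2"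
    by simp
  \<comment> \<open>The strict bound 1/2 excludes ties.\<close>
  then show "int (a n) = round (inverse (r - (\<Sum>k\<in>{1..<n}. 1 / real (a k))) + \<beta>)"
    using round_unique' by metis
next
  assume lim: "(\<lambda>n. real (a n) ^ 2 / real (a (n + 1))) \<longlonglongrightarrow> \<beta>"
  let ?d = "\<lambda>n. \<bar>inverse (r - (\<Sum>k\<in>{1..<n}. 1 / real (a k))) + \<beta> - real (a n)\<bar>"
  \<comment> \<open>The value \<open>a 0\<close> is unconstrained, so divergence is first shown for
    the sequence from index 1.\<close>
  have "filterlim (\<lambda>n. real (a (n + 1))) at_top sequentially"
    using assms(2) by (intro inverse_sums_imp_at_top[OF assms(4)]) auto
  then have a_top: "filterlim (\<lambda>n. real (a n)) at_top sequentially"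
    using filterlim_sequentially_Suc[of "\<lambda>n. real (a n)"] by simp
  show "?d \<longlonglongrightarrow> 0"
  proof (rule LIMSEQ_I)
    fix \<delta> :: real
    assume "0 < \<delta>"
    \<comment> \<open>The two entries are the thresholds for \<open>b_gt\<close> and
      \<open>large\<close> with \<open>\<eta> = \<delta> / 2\<close>, each solved for
      \<open>b k\<close>.\<close>
    define M where "M = max (\<beta> + \<delta>) (\<beta> * (\<beta> + \<delta> / 2) / (\<delta> / 2))"
    have "\<forall>\<^sub>F n in sequentially. dist ((real (a n))\<^sup>2 / real (a (n + 1))) \<beta> < \<delta> / 2 \<and> M < real (a n)"
      using tendstoD[OF lim, of "\<delta> / 2"] filterlim_at_top_dense[THEN iffD1, OF a_top] \<open>0 < \<delta>\<close>
      by (auto intro: eventually_conj)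
    then obtain N where N: "\<And>n. n \<ge> N \<Longrightarrow>
        dist ((real (a n))\<^sup>2 / real (a (n + 1))) \<beta> < \<delta> / 2 \<and> M < real (a n)"
      unfolding eventually_sequentially by blast
    have "?d n < \<delta>" if n: "n \<ge> max N 1" for n
    proof -
      have "\<bar>inverse (r - (\<Sum>k\<in>{1..<n}. 1 / real (a k))) + \<beta> - real (a (n + 0))\<bar> < \<delta>"
      proof (rule inverse_tail_approx[where b = "\<lambda>k. real (a (n + k))" and \<eta> = "\<delta> / 2"])
        fix k
        have Nk: "dist ((real (a (n + k)))\<^sup>2 / real (a (n + k + 1))) \<beta> < \<delta> / 2" "M < real (a (n + k))"
          using N[of "n + k"] n by auto
        show "\<bar>(real (a (n + k)))\<^sup>2 / real (a (n + Suc k)) - \<beta>\<bar> \<le> \<delta> / 2"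
          using Nk(1) by (simp add: dist_real_def)
        show "\<beta> + \<delta> < real (a (n + k))"
          using Nk(2) by (simp add: M_def)
        have "\<beta> * (\<beta> + \<delta> / 2) / (\<delta> / 2) < real (a (n + k))"
          using Nk(2) by (simp add: M_def)
        then have "\<beta> * (\<beta> + \<delta> / 2) < real (a (n + k)) * (\<delta> / 2)"
          using \<open>0 < \<delta>\<close> pos_divide_less_eq[of "\<delta> / 2"] by simp
        then show "\<beta> * (\<beta> + \<delta> / 2) \<le> real (a (n + k)) * (\<delta> - \<delta> / 2)"
          by simp
        show "(\<lambda>k. 1 / real (a (n + k))) sums (r - (\<Sum>k\<in>{1..<n}. 1 / real (a k)))"
          using n by (intro sums_tail[OF assms(4)]) simp
      qed (use assms(1) \<open>0 < \<delta>\<close> in auto)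
      then show ?thesis
        by simp
    qed
    then show "\<exists>no. \<forall>n\<ge>no. norm (?d n - 0) < \<delta>"
      by (intro exI[of _ "max N 1"]) simp
  qed
qed

end
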